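(* For a finite poset $P$, exactly one of the following holds. (i) $P$ has a forcing cycle $\mathcal C$ with $val(\mathcal C)>0$; in this case $P$ is not an $S$-order for any nonempty $S\subseteq\{A,B,C,D\}$. (ii) All forcing cycles $\mathcal C$ in $P$ have $val(\mathcal C)<0$; in this case $P$ is a unit interval order and an $S$-order for every nonempty $S\subseteq\{A,B,C,D\}$. (iii) No forcing cycle in $P$ has positive value and some forcing cycle has value $0$; in this case, for every value-$0$ forcing cycle $\mathcal C: x_0,x_1,\dots,x_t$ and every nonempty $S$, any $S$-representation of $P$ in which all intervals have length $2$ satisfies $c(x_i)=c(x_0)+val_{\mathcal C}(x_i)$ for all $0\le i\le t$.
   Context: Interval types: every interval $I_v$ has left endpoint $L(v)$, right endpoint $R(v)$, center $c(v)=(L(v)+R(v))/2$, and one of four types: $A$ (endpoints closed, center closed), $B$ (endpoints open, center open), $C$ (endpoints closed, center open), $D$ (endpoints open, center closed); the center always belongs to the interval. For nonempty $S\subseteq\{A,B,C,D\}$, an $S$-representation of a poset $(X,\prec)$ assigns to each $x\in X$ an interval $I_x$, all of the same positive length, each of type in $S$, such that $x\prec y$ iff (i) $R(x)<c(y)$, or (ii) $R(x)=c(y)$, at least one of $R(x),c(y)$ is open, and at least one of $L(y),c(x)$ is open. An $S$-order is a poset with an $S$-representation. A unit interval order is a poset representable by real intervals of equal length with $x\prec y$ iff every point of $I_x$ is less than every point of $I_y$. For distinct elements, $x\parallel y$ means incomparable. A forcing trail is a sequence $x_0,\dots,x_t$ with $x_i\prec x_{i+1}$ or $x_i\parallel x_{i+1}$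 for each $0\le i\le t-1$; $up_{\mathcal T}(x_i)$ (resp. $side_{\mathcal T}(x_i)$) is the number of $j\in\{0,\dots,i-1\}$ with $x_j\prec x_{j+1}$ (resp. $x_j\parallel x_{j+1}$), and $val_{\mathcal T}(x_i)=up_{\mathcal T}(x_i)-side_{\mathcal T}(x_i)$. A forcing cycle is a forcing trail $x_0,\dots,x_t$ with $t\ge1$ and $x_t=x_0$ (other repetitions allowed); its value is $val(\mathcal C)=val_{\mathcal C}(x_t)$. *)

theory Defs
  imports Complex_Main
begin

text \<open>A poset is a carrier \<open>X\<close> with a strict order \<open>lt\<close> that is irreflexive and transitive on \<open>X\<close>.\<close>

datatype interval_type = Type_A | Type_B | Type_C | Type_D

fun endpoints_open :: "interval_type \<Rightarrow> bool" where
  "endpoints_open Type_A = False"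
| "endpoints_open Type_B = True"
| "endpoints_open Type_C = False"
| "endpoints_open Type_D = True"

fun center_open :: "interval_type \<Rightarrow> bool" where
  "center_open Type_A = False"
| "center_open Type_B = True"
| "center_open Type_C = True"
| "center_open Type_D = False"

text \<open>
  The order of a representation depends only on the endpoints and on the open/closed marks of
  endpoints and center, so a typed interval carries exactly these data.
\<close>

datatype typed_interval =
  Typed_Interval (left_end: real) (right_end: real) (kind: interval_type)

definition ivl_center :: "typed_interval \<Rightarrow> real" where
  "ivl_center J = (left_end J + right_end J) / 2"

definition ivl_length :: "typed_interval \<Rightarrow> real" where
  "ivl_length J = right_end J - left_end J"

definition ivl_less :: "typed_interval \<Rightarrow> typed_interval \<Rightarrow> bool" where
  "ivl_less J K \<longleftrightarrow>
     right_end J < ivl_center K \<or>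
     (right_end J = ivl_center K \<and>
      (endpoints_open (kind J) \<or> center_open (kind K)) \<and>
      (endpoints_open (kind K) \<or> center_open (kind J)))"

definition S_representation ::
  "interval_type set \<Rightarrow> 'a set \<Rightarrow> ('a \<Rightarrow> 'a \<Rightarrow> bool) \<Rightarrow> ('a \<Rightarrow> typed_interval) \<Rightarrow> bool" where
  "S_representation S X lt I \<longleftrightarrow>
     (\<exists>len>0. \<forall>x\<in>X. ivl_length (I x) = len) \<and>
     (\<forall>x\<in>X. kind (I x) \<in> S) \<and>
     (\<forall>x\<in>X. \<forall>y\<in>X. lt x y \<longleftrightarrow> ivl_less (I x) (I y))"

definition S_order :: "interval_type set \<Rightarrow> 'a set \<Rightarrow> ('a \<Rightarrow> 'a \<Rightarrow> bool) \<Rightarrow> bool" where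
  "S_order S X lt \<longleftrightarrow> (\<exists>I. S_representation S X lt I)"

text \<open>
  The intervals are closed, as is standard. Allowing open and closed intervals to be mixed would
  give a strictly larger class of posets.
\<close>

definition unit_interval_order :: "'a set \<Rightarrow> ('a \<Rightarrow> 'a \<Rightarrow> bool) \<Rightarrow> bool" where
  "unit_interval_order X lt \<longleftrightarrow>
     (\<exists>l r :: 'a \<Rightarrow> real.
        (\<exists>len>0. \<forall>x\<in>X. r x - l x = len) \<and>
        (\<forall>x\<in>X. \<forall>y\<in>X. lt x y \<longleftrightarrow> (\<forall>p\<in>{l x..r x}. \<forall>q\<in>{l y..r y}. p < q)))"

definition incomparable :: "('a \<Rightarrow> 'a \<Rightarrow> bool) \<Rightarrow> 'a \<Rightarrow> 'a \<Rightarrow> bool" where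
  "incomparable lt x y \<longleftrightarrow> x \<noteq> y \<and> \<not> lt x y \<and> \<not> lt y x"

text \<open>A trail \<open>x\<^sub>0, \<dots>, x\<^sub>t\<close> is a function \<open>x\<close> on the naturals of which only the values up to \<open>t\<close> matter.\<close>

definition forcing_trail :: "'a set \<Rightarrow> ('a \<Rightarrow> 'a \<Rightarrow> bool) \<Rightarrow> (nat \<Rightarrow> 'a) \<Rightarrow> nat \<Rightarrow> bool" where
  "forcing_trail X lt x t \<longleftrightarrow>
     (\<forall>i\<le>t. x i \<in> X) \<and>
     (\<forall>i<t. lt (x i) (x (Suc i)) \<or> incomparable lt (x i) (x (Suc i)))"

definition trail_up :: "('a \<Rightarrow> 'a \<Rightarrow> bool) \<Rightarrow> (nat \<Rightarrow> 'a) \<Rightarrow> nat \<Rightarrow> nat" where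
  "trail_up lt x i = card {j. j < i \<and> lt (x j) (x (Suc j))}"

definition trail_side :: "('a \<Rightarrow> 'a \<Rightarrow> bool) \<Rightarrow> (nat \<Rightarrow> 'a) \<Rightarrow> nat \<Rightarrow> nat" where
  "trail_side lt x i = card {j. j < i \<and> incomparable lt (x j) (x (Suc j))}"

definition trail_val :: "('a \<Rightarrow> 'a \<Rightarrow> bool) \<Rightarrow> (nat \<Rightarrow> 'a) \<Rightarrow> nat \<Rightarrow> int" where
  "trail_val lt x i = int (trail_up lt x i) - int (trail_side lt x i)"

definition forcing_cycle :: "'a set \<Rightarrow> ('a \<Rightarrow> 'a \<Rightarrow> bool) \<Rightarrow> (nat \<Rightarrow> 'a) \<Rightarrow> nat \<Rightarrow> bool" where
  "forcing_cycle X lt x t \<longleftrightarrow> forcing_trail X lt x t \<and> 1 \<le> t \<and> x t = x 0"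

definition has_positive_cycle :: "'a set \<Rightarrow> ('a \<Rightarrow> 'a \<Rightarrow> bool) \<Rightarrow> bool" where
  "has_positive_cycle X lt \<longleftrightarrow> (\<exists>x t. forcing_cycle X lt x t \<and> trail_val lt x t > 0)"

definition all_cycles_negative :: "'a set \<Rightarrow> ('a \<Rightarrow> 'a \<Rightarrow> bool) \<Rightarrow> bool" where
  "all_cycles_negative X lt \<longleftrightarrow> (\<forall>x t. forcing_cycle X lt x t \<longrightarrow> trail_val lt x t < 0)"

definition max_cycle_value_zero :: "'a set \<Rightarrow> ('a \<Rightarrow> 'a \<Rightarrow> bool) \<Rightarrow> bool" where
  "max_cycle_value_zero X lt \<longleftrightarrow>
     \<not> (\<exists>x t. forcing_cycle X lt x t \<and> trail_val lt x t > 0) \<and>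
     (\<exists>x t. forcing_cycle X lt x t \<and> trail_val lt x t = 0)"

end

theory Submission
  imports Defs
begin

text \<open>
  In a representation with intervals of length \<open>2 * h\<close>, a step \<open>x \<prec> y\<close> of a trail forces
  \<open>c y - c x \<ge> h\<close> and a step \<open>x \<parallel> y\<close> forces \<open>c y - c x \<ge> - h\<close>, so a trail of value \<open>v\<close> raises the
  center by at least \<open>h * v\<close>. This excludes positive cycles, and on a cycle of value \<open>0\<close> the
  inequalities for the initial and the final part of the cycle together become equalities.

  If all cycles are negative, put \<open>N = card X + 1\<close> and let \<open>p x\<close> be the supremum of
  \<open>N * value + length\<close> over all trails that end in \<open>x\<close>. It is finite: cutting out a cycle of length
  less than \<open>N\<close> increases this quantity, so trails of length less than \<open>N\<close> suffice. The \<open>length\<close>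
  summand makes the resulting inequalities for \<open>p\<close> strict, and intervals of length \<open>2 * N\<close> with
  centers \<open>p x\<close> have no coincidence of an endpoint with a center; hence their types do not matter.
\<close>

section \<open>Trail values as sums over steps\<close>

definition step_val :: "('a \<Rightarrow> 'a \<Rightarrow> bool) \<Rightarrow> 'a \<Rightarrow> 'a \<Rightarrow> int" where
  "step_val lt x y = of_bool (lt x y) - of_bool (incomparable lt x y)"

lemma trail_val_eq_sum: "trail_val lt x i = (\<Sum>j<i. step_val lt (x j) (x (Suc j)))"
proof -
  have "int (card {j. j < i \<and> P j}) = (\<Sum>j<i. of_bool (P j))" for P
  proof -
    have "{j. j < i \<and> P j} = {..<i} \<inter> {j. P j}" by auto
    then show ?thesis by (simp add: of_bool_def sum.If_cases)
  qed
  then show ?thesis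
    by (simp add: trail_val_def trail_up_def trail_side_def step_val_def sum_subtractf)
qed

lemma trail_val_0 [simp]: "trail_val lt x 0 = 0"
  and trail_val_Suc [simp]:
    "trail_val lt x (Suc i) = trail_val lt x i + step_val lt (x i) (x (Suc i))"
  by (simp_all add: trail_val_eq_sum)

lemma trail_val_cong: "(\<And>k. k \<le> i \<Longrightarrow> x k = y k) \<Longrightarrow> trail_val lt x i = trail_val lt y i"
  by (simp add: trail_val_eq_sum)

lemma trail_val_add:
  "trail_val lt x (i + n) = trail_val lt x i + trail_val lt (\<lambda>k. x (i + k)) n"
  by (induction n) auto

lemma trail_val_le_length: "trail_val lt x i \<le> int i"
proof (induction i)
  case (Suc i)
  have "step_val lt (x i) (x (Suc i)) \<le> 1" by (simp add: step_val_def)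
  with Suc show ?case by simp
qed simp

section \<open>Cutting cycles out of trails\<close>

lemma forcing_trail_shift:
  "forcing_trail X lt x (i + n) \<Longrightarrow> forcing_trail X lt (\<lambda>k. x (i + k)) n"
  by (simp add: forcing_trail_def)

lemma forcing_trail_prefix: "forcing_trail X lt x t \<Longrightarrow> i \<le> t \<Longrightarrow> forcing_trail X lt x i"
  by (simp add: forcing_trail_def)

lemma forcing_trail_cut_cycle:
  assumes trail: "forcing_trail X lt x (i + d + n)" and eq: "x (i + d) = x i"
  obtains y where "forcing_trail X lt y (i + n)"
    and "trail_val lt x (i + d + n) = trail_val lt y (i + n) + trail_val lt (\<lambda>k. x (i + k)) d"
proof -
  define y where "y k = (if k \<le> i then x k else x (k + d))" for k
  have before: "y k = x k" if "k \<le> i" for k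
    using that by (simp add: y_def)
  \<comment> \<open>For \<open>k = 0\<close> the left side is still \<open>x i\<close>; only
    \<open>eq\<close> identifies it with the end of the removed piece.\<close>
  have after: "y (i + k) = x (i + d + k)" for k
    using eq by (cases "k = 0") (auto simp: y_def add_ac)
  have "forcing_trail X lt y (i + n)"
    unfolding forcing_trail_def
  proof (intro conjI allI impI)
    fix k assume "k \<le> i + n"
    then show "y k \<in> X"
      using trail by (auto simp: y_def forcing_trail_def)
  next
    fix k assume k: "k < i + n"
    show "lt (y k) (y (Suc k)) \<or> incomparable lt (y k) (y (Suc k))"
    proof (cases "k < i")
      case True
      then show ?thesis using trail by (simp add: before forcing_trail_def)
    next
      case False
      then obtain m where m: "k = i + m" using le_Suc_ex not_less by blast
      have "y (Suc k) = x (Suc (i + d + m))" using after[of "Suc m"] m by simp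
      then show ?thesis using trail after[of m] k m by (simp add: forcing_trail_def)
    qed
  qed
  moreover have "trail_val lt y (i + n) = trail_val lt x i + trail_val lt (\<lambda>k. x (i + d + k)) n"
    using trail_val_cong[of i y x lt] by (simp add: trail_val_add after before)
  ultimately show thesis
    by (intro that) (auto simp: trail_val_add)
qed

text \<open>Strong induction on the length. A trail of length at most \<open>card X\<close> has
  value at most its length, which gives the constant on the right. A longer one contains a short
  cycle, and removing it does not decrease the left side.\<close>

lemma forcing_trail_val_bound:
  fixes X :: "'a set"
  assumes fin: "finite X" and neg: "all_cycles_negative X lt"
    and trail: "forcing_trail X lt x t"
  shows "int (card X + 1) * trail_val lt x t + int t \<le> int (card X + 2) * int (card X)"
  using trail
proof (induction t arbitrary: x rule: less_induct)
  case (less t)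
  let ?n = "card X"
  show ?case
  proof (cases "t \<le> ?n")
    case True
    have "int (?n + 1) * trail_val lt x t \<le> int (?n + 1) * int t"
      by (intro mult_left_mono trail_val_le_length) simp
    then have "int (?n + 1) * trail_val lt x t + int t \<le> int (?n + 2) * int t"
      by (simp add: algebra_simps)
    also have "\<dots> \<le> int (?n + 2) * int ?n"
      using True by (intro mult_left_mono) auto
    finally show ?thesis .
  next
    case False
    \<comment> \<open>Looking for a repetition only among the first \<open>card X + 1\<close>
      vertices keeps the cycle length \<open>d\<close> at most \<open>card X\<close>, below the
      weight of the value.\<close>
    have "x ` {..?n} \<subseteq> X"
      using less.prems False by (auto simp: forcing_trail_def)
    then have "card (x ` {..?n}) < card {..?n}"
      using card_mono[OF fin, of "x ` {..?n}"] by simp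
    then have "\<not> inj_on x {..?n}" by (rule pigeonhole)
    then obtain i j where ij: "i < j" "j \<le> ?n" "x i = x j"
      unfolding inj_on_def by (metis atMost_iff linorder_neqE_nat)
    define d n where "d = j - i" and "n = t - j"
    have t: "t = i + d + n" and d: "0 < d" "d \<le> ?n" and eq: "x (i + d) = x i"
      using ij False by (auto simp: d_def n_def)
    obtain y where y: "forcing_trail X lt y (i + n)"
      and val: "trail_val lt x t = trail_val lt y (i + n) + trail_val lt (\<lambda>k. x (i + k)) d"
      using forcing_trail_cut_cycle less.prems eq unfolding t by blast
    have "forcing_cycle X lt (\<lambda>k. x (i + k)) d"
      using less.prems d eq forcing_trail_prefix[of X lt x t "i + d"]
      by (auto simp: forcing_cycle_def t intro!: forcing_trail_shift)
    then have "trail_val lt (\<lambda>k. x (i + k)) d \<le> -1"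
      using neg unfolding all_cycles_negative_def by force
    then have "int (?n + 1) * trail_val lt (\<lambda>k. x (i + k)) d \<le> int (?n + 1) * (-1)"
      by (intro mult_left_mono) auto
    \<comment> \<open>Removing the cycle gains at least \<open>card X + 1\<close> from the value and
      loses only \<open>d\<close> from the length.\<close>
    then have "int (?n + 1) * trail_val lt x t + int t
        \<le> int (?n + 1) * trail_val lt y (i + n) + int (i + n)"
      unfolding val distrib_left using d t by simp
    also have "\<dots> \<le> int (?n + 2) * int ?n"
      using less.IH[of "i + n" y] y d t by simp
    finally show ?thesis .
  qed
qed

section \<open>A strict potential from negative cycles\<close>

lemma all_cycles_negative_imp_potential:
  fixes X :: "'a set"
  assumes fin: "finite X" and neg: "all_cycles_negative X lt"
  obtains h :: real and p :: "'a \<Rightarrow> real" where "h > 0"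
    and "\<And>x y. x \<in> X \<Longrightarrow> y \<in> X \<Longrightarrow> lt x y \<Longrightarrow> p x + h < p y"
    and "\<And>x y. x \<in> X \<Longrightarrow> y \<in> X \<Longrightarrow> incomparable lt x y \<Longrightarrow> p x - h < p y"
proof -
  define N where "N = int (card X + 1)"
  define weights where "weights v =
    {real_of_int (N * trail_val lt x t + int t) |x t. forcing_trail X lt x t \<and> x t = v}" for v
  define p where "p v = Sup (weights v)" for v
  have bdd: "bdd_above (weights v)" for v
    unfolding weights_def bdd_above_def N_def
    using forcing_trail_val_bound[OF fin neg] of_int_le_iff by blast
  \<comment> \<open>Every trail ending in \<open>u\<close> extends by the edge to \<open>v\<close>.
    The summand 1 is the added length; with \<open>h = N\<close> it makes both inequalities
    strict.\<close>
  have step: "p u + real_of_int (N * step_val lt u v + 1) \<le> p v"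
    if uv: "u \<in> X" "v \<in> X" and edge: "lt u v \<or> incomparable lt u v" for u v
  proof -
    \<comment> \<open>The one-vertex trail keeps the supremum from being taken over the empty
      set.\<close>
    have "forcing_trail X lt (\<lambda>_. u) 0"
      using uv by (simp add: forcing_trail_def)
    then have "weights u \<noteq> {}"
      unfolding weights_def by blast
    moreover have "a \<le> p v - real_of_int (N * step_val lt u v + 1)" if a: "a \<in> weights u" for a
    proof -
      obtain x t where trail: "forcing_trail X lt x t" and "x t = u"
        and a_eq: "a = real_of_int (N * trail_val lt x t + int t)"
        using a unfolding weights_def by blast
      define y where "y = x(Suc t := v)"
      have "forcing_trail X lt y (Suc t)"
        using trail uv edge \<open>x t = u\<close>
        by (auto simp: forcing_trail_def y_def less_Suc_eq le_Suc_eq)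
      moreover have "trail_val lt y (Suc t) = trail_val lt x t + step_val lt u v"
        using trail_val_cong[of t y x lt] \<open>x t = u\<close> by (simp add: y_def)
      ultimately have "real_of_int (N * (trail_val lt x t + step_val lt u v) + int (Suc t))
          \<in> weights v"
        unfolding weights_def by (force simp: y_def)
      then have "real_of_int (N * (trail_val lt x t + step_val lt u v) + int (Suc t)) \<le> p v"
        unfolding p_def by (rule cSup_upper[OF _ bdd])
      then show ?thesis
        unfolding a_eq by (simp add: algebra_simps)
    qed
    ultimately have "p u \<le> p v - real_of_int (N * step_val lt u v + 1)"
      unfolding p_def[of u] by (rule cSup_least)
    then show ?thesis by simp
  qed
  show thesis
  proof (rule that[of "real_of_int N" p])
    show "real_of_int N > 0" by (simp add: N_def)
  next
    fix x y assume "x \<in> X" "y \<in> X" "lt x y"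
    then show "p x + real_of_int N < p y"
      using step[of x y] by (simp add: step_val_def incomparable_def)
  next
    fix x y assume "x \<in> X" "y \<in> X" "incomparable lt x y"
    then show "p x - real_of_int N < p y"
      using step[of x y] by (simp add: step_val_def incomparable_def)
  qed
qed

text \<open>The potential yields implications only. For the converse, if \<open>lt x y\<close>
  fails, then \<open>x = y\<close>, \<open>lt y x\<close> or \<open>y\<close> is incomparable to
  \<open>x\<close>, and each case gives \<open>p y < p x + h\<close>. This strictness also rules out
  equality.\<close>

lemma all_cycles_negative_imp_gap:
  fixes X :: "'a set"
  assumes "finite X" and "all_cycles_negative X lt"
  obtains h :: real and p :: "'a \<Rightarrow> real" where "h > 0"
    and "\<And>x y. x \<in> X \<Longrightarrow> y \<in> X \<Longrightarrow> lt x y \<longleftrightarrow> p x + h < p y"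
    and "\<And>x y. x \<in> X \<Longrightarrow> y \<in> X \<Longrightarrow> p x + h \<noteq> p y"
proof -
  obtain h :: real and p :: "'a \<Rightarrow> real" where h: "h > 0"
    and up: "\<And>x y. x \<in> X \<Longrightarrow> y \<in> X \<Longrightarrow> lt x y \<Longrightarrow> p x + h < p y"
    and side: "\<And>x y. x \<in> X \<Longrightarrow> y \<in> X \<Longrightarrow> incomparable lt x y \<Longrightarrow> p x - h < p y"
    by (rule all_cycles_negative_imp_potential[OF assms]) (rule that, auto)
  have not_lt: "p y < p x + h" if "x \<in> X" "y \<in> X" "\<not> lt x y" for x y
  proof -
    consider "x = y" | "lt y x" | "incomparable lt y x"
      using \<open>\<not> lt x y\<close> by (auto simp: incomparable_def)
    then show ?thesis
      using h up[of y x] side[of y x] that by cases auto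
  qed
  show thesis
  proof (rule that[OF h])
    fix x y assume "x \<in> X" "y \<in> X"
    then show "lt x y \<longleftrightarrow> p x + h < p y" "p x + h \<noteq> p y"
      using up[of x y] not_lt[of x y] by force+
  qed
qed

section \<open>Representations from the potential\<close>

lemma gap_imp_unit_interval_order:
  fixes p :: "'a \<Rightarrow> real"
  assumes "h > 0" and "\<And>x y. x \<in> X \<Longrightarrow> y \<in> X \<Longrightarrow> lt x y \<longleftrightarrow> p x + h < p y"
  shows "unit_interval_order X lt"
  unfolding unit_interval_order_def
\<comment> \<open>Here \<open>p\<close> gives left endpoints and \<open>h\<close> is the full
  length, so comparing a right with a left endpoint is the test
  \<open>p x + h < p y\<close>.\<close>
proof (rule exI[of _ p], rule exI[of _ "\<lambda>x. p x + h"], intro conjI ballI)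
  fix x y assume "x \<in> X" "y \<in> X"
  then have "lt x y \<longleftrightarrow> p x + h < p y" by (rule assms(2))
  also have "\<dots> \<longleftrightarrow> (\<forall>a\<in>{p x..p x + h}. \<forall>b\<in>{p y..p y + h}. a < b)"
    using \<open>h > 0\<close> by force
  finally show "lt x y \<longleftrightarrow> (\<forall>a\<in>{p x..p x + h}. \<forall>b\<in>{p y..p y + h}. a < b)" .
qed (use \<open>h > 0\<close> in auto)

lemma gap_imp_S_order:
  fixes p :: "'a \<Rightarrow> real"
  assumes "h > 0" and "\<And>x y. x \<in> X \<Longrightarrow> y \<in> X \<Longrightarrow> lt x y \<longleftrightarrow> p x + h < p y"
    and "\<And>x y. x \<in> X \<Longrightarrow> y \<in> X \<Longrightarrow> p x + h \<noteq> p y" and "S \<noteq> {}"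
  shows "S_order S X lt"
proof -
  obtain k where "k \<in> S" using \<open>S \<noteq> {}\<close> by blast
  \<comment> \<open>Now \<open>p\<close> gives centers and \<open>h\<close> is half the length.
    Since no right endpoint meets a center, the tie clause never applies, and one arbitrary type
    \<open>k\<close> serves all elements.\<close>
  then have "S_representation S X lt (\<lambda>x. Typed_Interval (p x - h) (p x + h) k)"
    unfolding S_representation_def using assms(1-3)
    by (auto simp: ivl_length_def ivl_less_def ivl_center_def intro!: exI[of _ "2 * h"])
  then show ?thesis unfolding S_order_def by blast
qed

section \<open>Constraints on arbitrary representations\<close>

lemma S_representation_center_ge:
  assumes rep: "S_representation S X lt I" and len: "\<forall>y\<in>X. ivl_length (I y) = 2 * h"
    and trail: "forcing_trail X lt x t"
  shows "ivl_center (I (x 0)) + h * of_int (trail_val lt x t) \<le> ivl_center (I (x t))"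
  using trail
proof (induction t)
  case (Suc t)
  let ?u = "x t" and ?v = "x (Suc t)"
  have uv: "?u \<in> X" "?v \<in> X" and edge: "lt ?u ?v \<or> incomparable lt ?u ?v"
    using Suc.prems by (auto simp: forcing_trail_def)
  have right: "right_end (I y) = ivl_center (I y) + h" if "y \<in> X" for y
    using len that by (force simp: ivl_center_def ivl_length_def field_simps)
  have less: "lt y z \<longleftrightarrow> ivl_less (I y) (I z)" if "y \<in> X" "z \<in> X" for y z
    using rep that by (simp add: S_representation_def)
  \<comment> \<open>Openness only decides ties, so weak inequalities hold for all types: an up step
    puts the right end of \<open>?u\<close> at or before the center of \<open>?v\<close>; a side
    step excludes \<open>lt ?v ?u\<close>, so the right end of \<open>?v\<close> is at or after the
    center of \<open>?u\<close>.\<close>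
  have "ivl_center (I ?u) + h * of_int (step_val lt ?u ?v) \<le> ivl_center (I ?v)"
    using edge
  proof
    assume "lt ?u ?v"
    then show ?thesis
      using less uv right by (auto simp: ivl_less_def step_val_def incomparable_def)
  next
    assume "incomparable lt ?u ?v"
    then show ?thesis
      using less[of ?v ?u] uv right by (auto simp: ivl_less_def step_val_def incomparable_def)
  qed
  moreover have "ivl_center (I (x 0)) + h * of_int (trail_val lt x t) \<le> ivl_center (I ?u)"
    using Suc.IH forcing_trail_prefix[OF Suc.prems] by simp
  ultimately show ?case by (simp add: algebra_simps)
qed simp

lemma has_positive_cycle_imp_not_S_order:
  assumes "has_positive_cycle X lt"
  shows "\<not> S_order S X lt"
proof
  assume "S_order S X lt"
  then obtain I len where rep: "S_representation S X lt I" and "len > 0"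
    and len: "\<forall>y\<in>X. ivl_length (I y) = 2 * (len / 2)"
    unfolding S_order_def S_representation_def by auto
  obtain x t where cycle: "forcing_cycle X lt x t" and "trail_val lt x t > 0"
    using assms unfolding has_positive_cycle_def by blast
  then have "len / 2 * of_int (trail_val lt x t) \<le> 0"
    using S_representation_center_ge[OF rep len, of x t] by (simp add: forcing_cycle_def)
  moreover have "len / 2 * of_int (trail_val lt x t) > 0"
    using \<open>len > 0\<close> \<open>trail_val lt x t > 0\<close> by simp
  ultimately show False by linarith
qed

lemma zero_cycle_center_eq:
  assumes cycle: "forcing_cycle X lt x t" and zero: "trail_val lt x t = 0"
    and rep: "S_representation S X lt I" and len: "\<forall>y\<in>X. ivl_length (I y) = 2" and "i \<le> t"
  shows "ivl_center (I (x i)) = ivl_center (I (x 0)) + of_int (trail_val lt x i)"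
proof -
  obtain n where t: "t = i + n" using \<open>i \<le> t\<close> le_Suc_ex by blast
  have trail: "forcing_trail X lt x (i + n)" and closed: "x (i + n) = x 0"
    using cycle by (auto simp: forcing_cycle_def t)
  have len': "\<forall>y\<in>X. ivl_length (I y) = 2 * 1" using len by simp
  have "ivl_center (I (x 0)) + of_int (trail_val lt x i) \<le> ivl_center (I (x i))"
    using S_representation_center_ge[OF rep len' forcing_trail_prefix[OF trail]] by simp
  \<comment> \<open>The rest of the cycle, from \<open>x i\<close> back to \<open>x 0\<close>,
    supplies the reverse inequality because its value is the negative of that of the initial
    part.\<close>
  moreover have
    "ivl_center (I (x i)) + of_int (trail_val lt (\<lambda>k. x (i + k)) n) \<le> ivl_center (I (x 0))"
    using S_representation_center_ge[OF rep len' forcing_trail_shift[OF trail]] closed by simp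
  moreover have "trail_val lt (\<lambda>k. x (i + k)) n = - trail_val lt x i"
    using zero by (simp add: t trail_val_add)
  ultimately show ?thesis by simp
qed

theorem theorem8:
  fixes X :: "'a set" and lt :: "'a \<Rightarrow> 'a \<Rightarrow> bool"
  assumes "finite X" and "irreflp_on X lt" and "transp_on X lt"
  shows
    "((has_positive_cycle X lt \<and> \<not> all_cycles_negative X lt \<and> \<not> max_cycle_value_zero X lt) \<or>
      (\<not> has_positive_cycle X lt \<and> all_cycles_negative X lt \<and> \<not> max_cycle_value_zero X lt) \<or>
      (\<not> has_positive_cycle X lt \<and> \<not> all_cycles_negative X lt \<and> max_cycle_value_zero X lt)) \<and>
     (has_positive_cycle X lt \<longrightarrow> (\<forall>S. S \<noteq> {} \<longrightarrow> \<not> S_order S X lt)) \<and>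
     (all_cycles_negative X lt \<longrightarrow>
        unit_interval_order X lt \<and> (\<forall>S. S \<noteq> {} \<longrightarrow> S_order S X lt)) \<and>
     (max_cycle_value_zero X lt \<longrightarrow>
        (\<forall>x t S I.
           forcing_cycle X lt x t \<and> trail_val lt x t = 0 \<and> S \<noteq> {} \<and>
           S_representation S X lt I \<and> (\<forall>y\<in>X. ivl_length (I y) = 2) \<longrightarrow>
           (\<forall>i\<le>t. ivl_center (I (x i)) = ivl_center (I (x 0)) + of_int (trail_val lt x i))))"
proof -
  have "unit_interval_order X lt \<and> (\<forall>S. S \<noteq> {} \<longrightarrow> S_order S X lt)"
    if "all_cycles_negative X lt"
  proof -
    obtain h :: real and p :: "'a \<Rightarrow> real" where "h > 0"
      and "\<And>x y. x \<in> X \<Longrightarrow> y \<in> X \<Longrightarrow> lt x y \<longleftrightarrow> p x + h < p y"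
      and "\<And>x y. x \<in> X \<Longrightarrow> y \<in> X \<Longrightarrow> p x + h \<noteq> p y"
      by (rule all_cycles_negative_imp_gap[OF assms(1) \<open>all_cycles_negative X lt\<close>])
        (rule that, auto)
    then show ?thesis
      using gap_imp_unit_interval_order[of h X lt p] gap_imp_S_order[of h X lt p] by blast
  qed
  \<comment> \<open>The three cases are a trichotomy by sign; a poset without forcing cycles, such
    as a chain, falls under the negative case vacuously.\<close>
  moreover have "all_cycles_negative X lt \<longleftrightarrow>
      \<not> has_positive_cycle X lt \<and> \<not> max_cycle_value_zero X lt"
    unfolding all_cycles_negative_def has_positive_cycle_def max_cycle_value_zero_def
    by (metis less_irrefl not_less_iff_gr_or_eq)
  moreover have "\<not> (has_positive_cycle X lt \<and> max_cycle_value_zero X lt)"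
    unfolding has_positive_cycle_def max_cycle_value_zero_def by blast
  moreover have "has_positive_cycle X lt \<longrightarrow> (\<forall>S. S \<noteq> {} \<longrightarrow> \<not> S_order S X lt)"
    using has_positive_cycle_imp_not_S_order by blast
  moreover have "\<forall>x t S I.
      forcing_cycle X lt x t \<and> trail_val lt x t = 0 \<and> S \<noteq> {} \<and>
      S_representation S X lt I \<and> (\<forall>y\<in>X. ivl_length (I y) = 2) \<longrightarrow>
      (\<forall>i\<le>t. ivl_center (I (x i)) = ivl_center (I (x 0)) + of_int (trail_val lt x i))"
    by (intro allI impI, elim conjE) (rule zero_cycle_center_eq)
  ultimately show ?thesis
    by argo
qed

end
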